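(* Let $n\geq 2$ and $1\leq m\leq n-1$. There exists a function $R_{m,n}\colon\mathbb{N}_0\to\mathbb{N}_0$ such that for any real-valued bihomogeneous polynomial $r(z,\bar z)$, $z\in\mathbb{C}^{n+1}$ (of any bidegree $(d,d)$), $$\operatorname{rank} r\leq R_{m,n}\Bigl(\max_{L\in G(m+1,n+1)}\operatorname{rank} r|_L\Bigr).$$
   Context: $\mathbb{N}_0=\mathbb{N}\cup\{0\}$. $G(m+1,n+1)$ is the Grassmannian of all $(m+1)$-dimensional complex linear subspaces of $\mathbb{C}^{n+1}$. A polynomial $r(z,\bar z)=\sum_{\alpha,\beta}c_{\alpha\beta}z^\alpha\bar z^\beta$ is bihomogeneous of bidegree $(d,d)$ if $r(tz,\bar z)=r(z,t\bar z)=t^d r(z,\bar z)$, treating $z$ and $\bar z$ as independent variables; that is, only $|\alpha|=|\beta|=d$ occur. It is real-valued if and only if its coefficient matrix $C=[c_{\alpha\beta}]$ is Hermitian. $\operatorname{rank} r$ is the rank of the matrix $C$. For $L\in G(m+1,n+1)$, $\operatorname{rank} r|_L:=\operatorname{rank}(r\circ E)$, where $E\colon\mathbb{C}^{m+1}\to\mathbb{C}^{n+1}$ is any injective linear map with image $L$; the rank does not depend on $E$. *)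

theory Defs
  imports
    "HOL-Library.Poly_Mapping"
    "HOL-Library.Product_Plus"
    "Jordan_Normal_Form.DL_Rank"
begin

text \<open>
  A polynomial in \<open>z\<close> and \<open>\<bar>z\<close>, regarded as independent variables: \<open>lookup r (\<alpha>, \<beta>)\<close> is the
  coefficient \<open>c\<^sub>\<alpha>\<^sub>\<beta>\<close> of \<open>z\<^sup>\<alpha> \<bar>z\<^sup>\<beta>\<close>. The ring structure is the one of finitely supported functions on
  the additive monoid of pairs of exponents. The \<open>k\<close> variables of \<open>\<complex>\<^sup>k\<close> have the indices
  \<open>0, \<dots>, k - 1\<close>.
\<close>

type_synonym multiindex = "nat \<Rightarrow>\<^sub>0 nat"
type_synonym zzbar_poly = "(multiindex \<times> multiindex) \<Rightarrow>\<^sub>0 complex"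

definition multiindices :: "nat \<Rightarrow> nat \<Rightarrow> multiindex set" where
  "multiindices k d = {\<alpha>. Poly_Mapping.keys \<alpha> \<subseteq> {..<k} \<and> (\<Sum>i<k. Poly_Mapping.lookup \<alpha> i) = d}"

lemma finite_multiindices: "finite (multiindices k d)"
proof (rule finite_subset)
  let ?F = "{f. \<forall>i. (i \<in> {..<k} \<longrightarrow> f i \<in> {..d}) \<and> (i \<notin> {..<k} \<longrightarrow> f i = (0::nat))}"
  have "finite ?F" by (rule finite_set_of_finite_funs) auto
  then show "finite (Poly_Mapping.lookup -` ?F)"
    by (rule finite_vimageI) (rule injI, simp only: Poly_Mapping.lookup_inject)
  show "multiindices k d \<subseteq> Poly_Mapping.lookup -` ?F"
  proof (intro subsetI vimageI2 CollectI conjI allI impI)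
    fix \<alpha> i assume \<alpha>: "\<alpha> \<in> multiindices k d"
    show "Poly_Mapping.lookup \<alpha> i \<in> {..d}" if "i \<in> {..<k}"
      using member_le_sum[OF that, of "Poly_Mapping.lookup \<alpha>"] \<alpha> by (simp add: multiindices_def)
    show "Poly_Mapping.lookup \<alpha> i = 0" if "i \<notin> {..<k}"
    proof -
      have "i \<notin> Poly_Mapping.keys \<alpha>" using \<alpha> that unfolding multiindices_def by blast
      then show ?thesis by (simp only: in_keys_iff not_not)
    qed
  qed
qed

definition bihomogeneous :: "nat \<Rightarrow> nat \<Rightarrow> zzbar_poly \<Rightarrow> bool" where
  "bihomogeneous k d r \<longleftrightarrow>
     (\<forall>(\<alpha>, \<beta>)\<in>Poly_Mapping.keys r. \<alpha> \<in> multiindices k d \<and> \<beta> \<in> multiindices k d)"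

definition monomial_value :: "nat \<Rightarrow> complex vec \<Rightarrow> multiindex \<Rightarrow> complex" where
  "monomial_value k z \<alpha> = (\<Prod>i<k. (z $ i) ^ Poly_Mapping.lookup \<alpha> i)"

definition poly_value :: "nat \<Rightarrow> zzbar_poly \<Rightarrow> complex vec \<Rightarrow> complex" where
  "poly_value k r z =
     (\<Sum>(\<alpha>, \<beta>)\<in>Poly_Mapping.keys r.
        Poly_Mapping.lookup r (\<alpha>, \<beta>) * monomial_value k z \<alpha> * cnj (monomial_value k z \<beta>))"

definition real_valued :: "nat \<Rightarrow> zzbar_poly \<Rightarrow> bool" where
  "real_valued k r \<longleftrightarrow> (\<forall>z\<in>carrier_vec k. poly_value k r z \<in> \<real>)"

text \<open>
  The coefficient matrix \<open>[c\<^sub>\<alpha>\<^sub>\<beta>]\<close> of a polynomial of bidegree \<open>(d, d)\<close>. Its rows and columns are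
  numbered by listing the (finitely many) multiindices of degree \<open>d\<close> in
  increasing order; the rank does not depend on this choice of order.
\<close>

definition coeff_mat :: "nat \<Rightarrow> nat \<Rightarrow> zzbar_poly \<Rightarrow> complex mat" where
  "coeff_mat k d r =
     (let as = sorted_list_of_set (multiindices k d)
      in mat (length as) (length as) (\<lambda>(i, j). Poly_Mapping.lookup r (as ! i, as ! j)))"

definition poly_rank :: "nat \<Rightarrow> nat \<Rightarrow> zzbar_poly \<Rightarrow> nat" where
  "poly_rank k d r = vec_space.rank (dim_row (coeff_mat k d r)) (coeff_mat k d r)"

text \<open>
  For \<open>E :: \<complex>\<^sup>l \<rightarrow> \<complex>\<^sup>k\<close>, given by a \<open>k \<times> l\<close> matrix, \<open>r \<circ> E\<close> is obtained by substituting
  \<open>z\<^sub>i \<mapsto> \<Sum>\<^sub>j E\<^sub>i\<^sub>j z\<^sub>j\<close> and the conjugate \<open>\<bar>z\<^sub>i \<mapsto> \<Sum>\<^sub>j \<bar>E\<^sub>i\<^sub>j \<bar>z\<^sub>j\<close>.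
\<close>

definition const_poly :: "complex \<Rightarrow> zzbar_poly" where
  "const_poly c = Poly_Mapping.single 0 c"

definition z_var :: "nat \<Rightarrow> zzbar_poly" where
  "z_var j = Poly_Mapping.single (Poly_Mapping.single j 1, 0) 1"

definition zbar_var :: "nat \<Rightarrow> zzbar_poly" where
  "zbar_var j = Poly_Mapping.single (0, Poly_Mapping.single j 1) 1"

definition compose_linear :: "zzbar_poly \<Rightarrow> complex mat \<Rightarrow> zzbar_poly" where
  "compose_linear r E =
     (\<Sum>(\<alpha>, \<beta>)\<in>Poly_Mapping.keys r.
        const_poly (Poly_Mapping.lookup r (\<alpha>, \<beta>))
        * (\<Prod>i<dim_row E. (\<Sum>j<dim_col E. const_poly (E $$ (i, j)) * z_var j)
             ^ Poly_Mapping.lookup \<alpha> i)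
        * (\<Prod>i<dim_row E. (\<Sum>j<dim_col E. const_poly (cnj (E $$ (i, j))) * zbar_var j)
             ^ Poly_Mapping.lookup \<beta> i))"

definition grassmannian :: "nat \<Rightarrow> nat \<Rightarrow> complex vec set set" where
  "grassmannian l k =
     {L. VectorSpace.subspace class_ring L (module_vec TYPE(complex) k) \<and>
         vectorspace.dim class_ring ((module_vec TYPE(complex) k)\<lparr>carrier := L\<rparr>) = l}"

definition parametrizes :: "nat \<Rightarrow> nat \<Rightarrow> complex mat \<Rightarrow> complex vec set \<Rightarrow> bool" where
  "parametrizes l k E L \<longleftrightarrow> E \<in> carrier_mat k l \<and>
     inj_on (\<lambda>v. E *\<^sub>v v) (carrier_vec l) \<and> (\<lambda>v. E *\<^sub>v v) ` carrier_vec l = L"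

text \<open>
  The rank of the restriction to an \<open>l\<close>-dimensional subspace \<open>L\<close> of \<open>\<complex>\<^sup>k\<close>. It does not depend on
  the parametrization that is chosen.
\<close>

definition restriction_rank :: "nat \<Rightarrow> nat \<Rightarrow> nat \<Rightarrow> zzbar_poly \<Rightarrow> complex vec set \<Rightarrow> nat" where
  "restriction_rank l k d r L = poly_rank l d (compose_linear r (SOME E. parametrizes l k E L))"

lemma poly_rank_le: "poly_rank k d r \<le> card (multiindices k d)"
proof -
  have "coeff_mat k d r \<in> carrier_mat (dim_row (coeff_mat k d r)) (card (multiindices k d))"
    by (rule carrier_matI) (simp_all only: coeff_mat_def Let_def dim_col_mat length_sorted_list_of_set)
  from vec_space.rank_le_nc[OF this] show ?thesis unfolding poly_rank_def .
qed

lemma finite_restriction_ranks: "finite (restriction_rank l k d r ` A)"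
proof (rule finite_subset)
  show "restriction_rank l k d r ` A \<subseteq> {..card (multiindices l d)}"
    unfolding restriction_rank_def using poly_rank_le by blast
qed simp

end

theory Submission
  imports Defs "Jordan_Normal_Form.Char_Poly"
begin

text \<open>
  Write \<open>r(z, w)\<close> for the polynomial with \<open>z\<close> and \<open>\<bar>z\<close> made independent. Its rank is the least \<open>s\<close> with
  \<open>r(z, w) = \<Sum>\<^sub>j\<^sub><\<^sub>s f\<^sub>j(z) g\<^sub>j(w)\<close> for arbitrary functions \<open>f\<^sub>j\<close>, \<open>g\<^sub>j\<close>, and rank at most \<open>s\<close> means that
  all minors of size \<open>s + 1\<close> of \<open>r(z\<^sub>i, w\<^sub>j)\<close> vanish. If all restrictions to subspaces have rank at
  most \<open>K\<close>, then these minors vanish for \<open>z\<^sub>i = E x\<^sub>i\<close>, \<open>w\<^sub>j = \<bar>E y\<^sub>j\<close>; being polynomial in \<open>E\<close> and \<open>\<bar>E\<close>,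
  they also vanish for \<open>z\<^sub>i = E x\<^sub>i\<close>, \<open>w\<^sub>j = F y\<^sub>j\<close> with unrelated \<open>E\<close> and \<open>F\<close>. As an affine line lies in a
  two-dimensional subspace, \<open>r\<close> has rank at most \<open>K\<close> on every product of two lines parallel to
  coordinate axes.

  The bound is propagated one coordinate at a time. Let \<open>G(x, y; w)\<close> be polynomial in \<open>x\<close>, of rank at
  most \<open>K\<close> in \<open>(y; w)\<close> for each \<open>x\<close> and of rank at most \<open>A\<close> in \<open>(x; w)\<close> for each \<open>y\<close>. A maximal
  nonvanishing minor in \<open>(y; w)\<close> gives points \<open>y\<^sub>1, \<dots>, y\<^sub>s\<close> with \<open>s \<le> K\<close> that do not depend on \<open>x\<close>, such
  that \<open>G(x, y; w) = \<Sum>\<^sub>i c\<^sub>i(x, y) G(x, y\<^sub>i; w)\<close> for generic \<open>x\<close>; so \<open>G\<close> has rank at most \<open>K A\<close> in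
  \<open>((x, y); w)\<close>. In \<open>k\<close> variables this gives \<open>K\<^sup>k\<close> on a line times the whole space, and then
  \<open>(K\<^sup>k)\<^sup>k\<close> for \<open>r\<close>.
\<close>

section \<open>Kernels of finite rank\<close>

text \<open>The factors are arbitrary functions, so quotients of cofactors and substitutions by
  arbitrary maps are allowed in a factorization.\<close>

definition kernel_rank_le :: "nat \<Rightarrow> ('a \<Rightarrow> 'b \<Rightarrow> 'c::field) \<Rightarrow> bool" where
  "kernel_rank_le s H \<longleftrightarrow> (\<exists>f g. \<forall>x y. H x y = (\<Sum>j<s. f j x * g j y))"

definition minor_det :: "nat \<Rightarrow> ('a \<Rightarrow> 'b \<Rightarrow> 'c::field) \<Rightarrow> (nat \<Rightarrow> 'a) \<Rightarrow> (nat \<Rightarrow> 'b) \<Rightarrow> 'c" where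
  "minor_det s H xs ys = det (mat s s (\<lambda>(i, j). H (xs i) (ys j)))"

lemma kernel_rank_leI:
  assumes "\<And>x y. H x y = (\<Sum>j<s. f j x * g j y)"
  shows "kernel_rank_le s H"
  unfolding kernel_rank_le_def using assms by blast

lemma kernel_rank_le_precomp:
  assumes "kernel_rank_le s H"
  shows "kernel_rank_le s (\<lambda>x y. H (\<phi> x) (\<psi> y))"
proof -
  from assms obtain f g where "\<And>x y. H x y = (\<Sum>j<s. f j x * g j y)"
    unfolding kernel_rank_le_def by blast
  then show ?thesis by (intro kernel_rank_leI[where f = "\<lambda>j x. f j (\<phi> x)" and g = "\<lambda>j y. g j (\<psi> y)"]) simp
qed

lemma kernel_rank_le_scale:
  assumes "kernel_rank_le s H"
  shows "kernel_rank_le s (\<lambda>x y. c x * H x y)"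
proof -
  from assms obtain f g where "\<And>x y. H x y = (\<Sum>j<s. f j x * g j y)"
    unfolding kernel_rank_le_def by blast
  then show ?thesis
    by (intro kernel_rank_leI[where f = "\<lambda>j x. c x * f j x" and g = g]) (simp add: sum_distrib_left mult.assoc)
qed

lemma kernel_rank_le_swap:
  assumes "kernel_rank_le s H"
  shows "kernel_rank_le s (\<lambda>y x. H x y)"
proof -
  from assms obtain f g where "\<And>x y. H x y = (\<Sum>j<s. f j x * g j y)"
    unfolding kernel_rank_le_def by blast
  then show ?thesis by (intro kernel_rank_leI[where f = g and g = f]) (simp add: mult.commute)
qed

lemma kernel_rank_le_zero: "kernel_rank_le 0 H \<longleftrightarrow> (\<forall>x y. H x y = 0)"
  unfolding kernel_rank_le_def by simp

lemma kernel_rank_le_add: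
  assumes "kernel_rank_le a H" "kernel_rank_le b K"
  shows "kernel_rank_le (a + b) (\<lambda>x y. H x y + K x y)"
proof -
  from assms obtain f g f' g' where H: "\<And>x y. H x y = (\<Sum>j<a. f j x * g j y)"
    and K: "\<And>x y. K x y = (\<Sum>j<b. f' j x * g' j y)"
    unfolding kernel_rank_le_def by metis
  have split: "(\<Sum>j<a + b. h j) = (\<Sum>j<a. h j) + (\<Sum>j<b. h (a + j))" for h :: "nat \<Rightarrow> 'c"
    by (induction b) (simp_all add: add.assoc)
  show ?thesis
    by (rule kernel_rank_leI[where f = "\<lambda>j. if j < a then f j else f' (j - a)"
          and g = "\<lambda>j. if j < a then g j else g' (j - a)"]) (simp add: split H K)
qed

lemma kernel_rank_le_sum:
  assumes "\<And>i. i < s \<Longrightarrow> kernel_rank_le a (H i)"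
  shows "kernel_rank_le (s * a) (\<lambda>x y. \<Sum>i<s. H i x y)"
  using assms
proof (induction s)
  case 0
  then show ?case by (simp add: kernel_rank_le_zero)
next
  case (Suc s)
  then show ?case using kernel_rank_le_add[of "s * a" "\<lambda>x y. \<Sum>i<s. H i x y" a "H s"]
    by (simp add: add.commute)
qed

lemma kernel_rank_le_mono:
  assumes "kernel_rank_le a H" "a \<le> b"
  shows "kernel_rank_le b H"
proof -
  have "kernel_rank_le (b - a) (\<lambda>(x::'a) (y::'b). 0::'c)"
    by (rule kernel_rank_leI[where f = "\<lambda>_ _. 0" and g = "\<lambda>_ _. 0"]) simp
  from kernel_rank_le_add[OF assms(1) this] assms(2) show ?thesis by simp
qed

section \<open>Rank bounds and vanishing minors\<close>

lemma minor_det_eq_0: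
  assumes "kernel_rank_le s H"
  shows "minor_det (Suc s) H xs ys = 0"
proof -
  from assms obtain f g where H: "\<And>x y. H x y = (\<Sum>j<s. f j x * g j y)"
    unfolding kernel_rank_le_def by blast
  \<comment> \<open>The factorization of inner size \<open>s\<close> is padded by zeros to one of square matrices.\<close>
  define A where "A = mat (Suc s) (Suc s) (\<lambda>(i, j). if j < s then f j (xs i) else 0)"
  define B where "B = mat (Suc s) (Suc s) (\<lambda>(i, j). if i < s then g i (ys j) else 0)"
  have carr: "A \<in> carrier_mat (Suc s) (Suc s)" "B \<in> carrier_mat (Suc s) (Suc s)"
    by (simp_all add: A_def B_def)
  have "mat (Suc s) (Suc s) (\<lambda>(i, j). H (xs i) (ys j)) = A * B"
    by (rule eq_matI)
      (auto simp: A_def B_def H scalar_prod_def atLeast0LessThan intro!: sum.cong)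
  moreover have "det A = 0"
    by (subst laplace_expansion_column[OF carr(1), of s]) (auto simp: A_def)
  ultimately show ?thesis by (simp add: minor_det_def det_mult[OF carr])
qed

text \<open>Border the nonzero minor by a row for \<open>x\<close> and a column for \<open>y\<close>
  and expand the vanishing determinant along that column: the cofactor of \<open>H x y\<close> is
  the nonzero minor, and the other cofactors depend on \<open>x\<close> only.\<close>

lemma cramer_kernel:
  assumes nz: "minor_det s H xs ys \<noteq> 0"
    and zero: "\<And>xs ys. minor_det (Suc s) H xs ys = 0"
  shows "\<exists>c. \<forall>x y. H x y = (\<Sum>i<s. c i x * H (xs i) y)"
proof -
  define M where "M x y = mat (Suc s) (Suc s)
    (\<lambda>(i, j). H (if i < s then xs i else x) (if j < s then ys j else y))" for x y
  \<comment> \<open>Deleting the last column removes \<open>y\<close>, so \<open>ys 0\<close> is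
    only a placeholder.\<close>
  define cof where "cof i x = cofactor (M x (ys 0)) i s" for i x
  have cof: "cofactor (M x y) i s = cof i x" if "i \<le> s" for i x y
  proof -
    have "mat_delete (M x y) i s = mat_delete (M x (ys 0)) i s"
      by (rule eq_matI) (auto simp: mat_delete_def M_def)
    then show ?thesis by (simp add: cof_def cofactor_def)
  qed
  have cofs: "cof s x = minor_det s H xs ys" for x
  proof -
    have "mat_delete (M x (ys 0)) s s = mat s s (\<lambda>(i, j). H (xs i) (ys j))"
      by (rule eq_matI) (auto simp: mat_delete_def M_def)
    then show ?thesis by (simp add: cof_def cofactor_def minor_det_def)
  qed
  have eq: "(\<Sum>i<s. H (xs i) y * cof i x) + H x y * minor_det s H xs ys = 0" for x y
  proof -
    have "0 = minor_det (Suc s) H (\<lambda>i. if i < s then xs i else x) (\<lambda>j. if j < s then ys j else y)"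
      by (simp add: zero)
    also have "\<dots> = det (M x y)" by (simp add: minor_det_def M_def)
    also have "\<dots> = (\<Sum>i<Suc s. M x y $$ (i, s) * cofactor (M x y) i s)"
      by (rule laplace_expansion_column) (simp_all add: M_def)
    also have "\<dots> = (\<Sum>i<s. H (xs i) y * cof i x) + H x y * minor_det s H xs ys"
      by (simp add: cof cofs) (simp add: M_def)
    finally show ?thesis by simp
  qed
  show ?thesis
  proof (intro exI allI)
    fix x y
    have "H x y * minor_det s H xs ys = - (\<Sum>i<s. H (xs i) y * cof i x)"
      using eq[of y x] by (simp add: eq_neg_iff_add_eq_0 add.commute)
    then have "H x y = - (\<Sum>i<s. H (xs i) y * cof i x) / minor_det s H xs ys"
      using nz by (simp add: field_simps)
    also have "\<dots> = (\<Sum>i<s. (- cof i x / minor_det s H xs ys) * H (xs i) y)"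
      by (simp add: sum_negf[symmetric] sum_divide_distrib mult.commute)
    finally show "H x y = (\<Sum>i<s. (- cof i x / minor_det s H xs ys) * H (xs i) y)" .
  qed
qed

text \<open>Induction on \<open>s\<close>: a nonzero minor of size \<open>Suc s\<close> gives a
  factorization of length \<open>Suc s\<close> by Cramer's rule; if there is none, the rank is at
  most \<open>s\<close> already.\<close>

lemma kernel_rank_leI_minor_det:
  assumes "\<And>xs ys. minor_det (Suc s) H xs ys = 0"
  shows "kernel_rank_le s H"
  using assms
proof (induction s)
  case 0
  have "H x y = 0" for x y
    using 0[of "\<lambda>_. x" "\<lambda>_. y"] by (simp add: minor_det_def det_single)
  then show ?case by (simp add: kernel_rank_le_zero)
next
  case (Suc s)
  show ?case
  proof (cases "\<forall>xs ys. minor_det (Suc s) H xs ys = 0")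
    case True
    then show ?thesis using Suc.IH kernel_rank_le_mono[of s H "Suc s"] by simp
  next
    case False
    then obtain xs ys where "minor_det (Suc s) H xs ys \<noteq> 0" by blast
    from cramer_kernel[OF this Suc.prems] obtain c
      where "\<forall>x y. H x y = (\<Sum>i<Suc s. c i x * H (xs i) y)" by blast
    then show ?thesis by (intro kernel_rank_leI[where f = c and g = "\<lambda>i. H (xs i)"]) blast
  qed
qed

section \<open>Propagation of rank bounds from one coordinate to several\<close>

text \<open>Points have infinitely many coordinates; restriction to lines reduces genericity
  arguments to univariate polynomials.\<close>

definition poly_on_lines :: "((nat \<Rightarrow> 'c::field_char_0) \<Rightarrow> 'c) \<Rightarrow> bool" where
  "poly_on_lines g \<longleftrightarrow> (\<forall>a b. \<exists>p. \<forall>t. g (\<lambda>i. a i + t * b i) = poly p t)"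

lemma poly_on_linesD:
  assumes "poly_on_lines g"
  shows "\<exists>p. \<forall>t. g (\<lambda>i. a i + t * b i) = poly p t"
  using assms unfolding poly_on_lines_def by simp

text \<open>Evaluation at \<open>t\<close> is a ring homomorphism and so commutes with the
  determinant.\<close>

lemma det_poly_entries:
  fixes M :: "'c::comm_ring_1 \<Rightarrow> nat \<Rightarrow> nat \<Rightarrow> 'c"
  assumes "\<And>i j. i < s \<Longrightarrow> j < s \<Longrightarrow> \<exists>p. \<forall>t. M t i j = poly p t"
  shows "\<exists>p. \<forall>t. det (mat s s (\<lambda>(i, j). M t i j)) = poly p t"
proof -
  define P where "P i j = (SOME p. \<forall>t. M t i j = poly p t)" for i j
  have P: "M t i j = poly (P i j) t" if "i < s" "j < s" for i j :: nat and t :: 'c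
    using someI_ex[OF assms[OF that]] unfolding P_def by blast
  show ?thesis
  proof (intro exI allI)
    fix t :: 'c
    have hom: "comm_ring_hom (\<lambda>p. poly p t)" by unfold_locales auto
    have "mat s s (\<lambda>(i, j). M t i j) = map_mat (\<lambda>p. poly p t) (mat s s (\<lambda>(i, j). P i j))"
      by (rule eq_matI) (auto simp: P)
    then show "det (mat s s (\<lambda>(i, j). M t i j)) = poly (det (mat s s (\<lambda>(i, j). P i j))) t"
      by (simp add: comm_ring_hom.hom_det[OF hom])
  qed
qed

lemma poly_nonzero_point:
  fixes p :: "'c::field_char_0 poly"
  assumes "p \<noteq> 0"
  obtains t where "poly p t \<noteq> 0"
proof -
  have "{t. poly p t = 0} \<noteq> UNIV"
    using poly_roots_finite[OF assms] infinite_UNIV_char_0[where 'a = 'c] by auto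
  then show thesis using that by blast
qed

text \<open>Where the minor \<open>D\<close> is nonzero, \<open>s\<close> fixed values of
  \<open>y\<close> suffice, each contributing rank at most \<open>A\<close>; the exceptional
  \<open>x\<close> are handled by moving points along lines.\<close>

lemma kernel_rank_le_prod:
  fixes G :: "(nat \<Rightarrow> 'c::field_char_0) \<Rightarrow> 'b \<Rightarrow> 'w \<Rightarrow> 'c"
  assumes poly: "\<And>y w. poly_on_lines (\<lambda>x. G x y w)"
    and cols: "\<And>y. kernel_rank_le A (\<lambda>x w. G x y w)"
    and rows: "\<And>x. kernel_rank_le K (G x)"
  shows "kernel_rank_le (K * A) (\<lambda>(x, y) w. G x y w)"
proof -
  define P where "P s \<longleftrightarrow> (\<exists>x ys ws. minor_det s (G x) ys ws \<noteq> 0)" for s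
  have "\<not> P (Suc K)" unfolding P_def using minor_det_eq_0[OF rows] by blast
  have "P 0" by (simp add: P_def minor_det_def)
  \<comment> \<open>\<open>P\<close> holds at 0 and fails at \<open>Suc K\<close>, so it switches
    from true to false somewhere in between.\<close>
  have "\<exists>s\<le>K. P s \<and> \<not> P (Suc s)"
  proof (rule ccontr)
    assume *: "\<not> ?thesis"
    have "P s" if "s \<le> Suc K" for s
      using that by (induction s) (use \<open>P 0\<close> * in auto)
    with \<open>\<not> P (Suc K)\<close> show False by blast
  qed
  then obtain s x0 ys ws where "s \<le> K" and x0: "minor_det s (G x0) ys ws \<noteq> 0"
    and max: "\<And>x ys ws. minor_det (Suc s) (G x) ys ws = 0"
    unfolding P_def by blast
  define D where "D x = minor_det s (G x) ys ws" for x
  have "\<forall>x. \<exists>c. D x \<noteq> 0 \<longrightarrow> (\<forall>y w. G x y w = (\<Sum>i<s. c i y * G x (ys i) w))"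
    using cramer_kernel[OF _ max] unfolding D_def by blast
  from choice[OF this] obtain c
    where c: "\<And>x y w. D x \<noteq> 0 \<Longrightarrow> G x y w = (\<Sum>i<s. c x i y * G x (ys i) w)"
    by blast
  \<comment> \<open>Cutting \<open>G\<close> off where \<open>D\<close> vanishes makes the Cramer
    formula valid for all \<open>x\<close>.\<close>
  define H where "H = (\<lambda>(x, y) w. if D x \<noteq> 0 then G x y w else 0)"
  have "kernel_rank_le (s * A) (\<lambda>q w. \<Sum>i<s. (if D (fst q) \<noteq> 0 then c (fst q) i (snd q) else 0)
          * G (fst q) (ys i) w)"
    by (intro kernel_rank_le_sum kernel_rank_le_scale)
      (rule kernel_rank_le_precomp[OF cols, where \<phi> = fst and \<psi> = "\<lambda>w. w"])
  also have "(\<lambda>q w. \<Sum>i<s. (if D (fst q) \<noteq> 0 then c (fst q) i (snd q) else 0) * G (fst q) (ys i) w) = H"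
  proof (intro ext)
    fix q w
    show "(\<Sum>i<s. (if D (fst q) \<noteq> 0 then c (fst q) i (snd q) else 0) * G (fst q) (ys i) w) = H q w"
      using c[of "fst q" "snd q" w] by (cases "D (fst q) = 0") (simp_all add: H_def split_beta)
  qed
  finally have H: "kernel_rank_le (s * A) H" .
  define N where "N = Suc (s * A)"
  have "minor_det N (\<lambda>(x, y) w. G x y w) ps vs = 0" for ps vs
  proof (rule ccontr)
    assume nz: "minor_det N (\<lambda>(x, y) w. G x y w) ps vs \<noteq> 0"
    \<comment> \<open>All points are moved simultaneously towards \<open>x0\<close>, where \<open>D\<close> does not vanish.\<close>
    define X where "X t a = (\<lambda>i. fst (ps a) i + t * (x0 i - fst (ps a) i))" for t a
    have X0: "X 0 a = fst (ps a)" and X1: "X 1 a = x0" for a by (simp_all add: X_def)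
    have GX: "\<exists>p. \<forall>t. G (X t a) y w = poly p t" for a y w
      unfolding X_def by (rule poly_on_linesD[OF poly])
    obtain q where q: "\<And>t. minor_det N (\<lambda>(x, y) w. G x y w) (\<lambda>a. (X t a, snd (ps a))) vs = poly q t"
      using det_poly_entries[of N "\<lambda>t i j. G (X t i) (snd (ps i)) (vs j)"] GX
      unfolding minor_det_def by auto
    have "\<exists>p. \<forall>t. D (X t a) = poly p t" for a
      using det_poly_entries[of s "\<lambda>t i j. G (X t a) (ys i) (ws j)"] GX
      unfolding minor_det_def D_def by auto
    then obtain r where r: "\<And>t a. D (X t a) = poly (r a) t" by metis
    have "poly q 0 \<noteq> 0" using nz by (simp add: q[symmetric] X0)
    moreover have "poly (r a) 1 \<noteq> 0" for a using x0 by (simp add: r[symmetric] X1) (simp add: D_def)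
    ultimately have "q \<noteq> 0" "\<And>a. r a \<noteq> 0" by (metis poly_0)+
    then have "q * (\<Prod>a<N. r a) \<noteq> 0" by simp
    \<comment> \<open>\<open>q\<close> is nonzero at 0 and every \<open>r a\<close> at 1, so one
      \<open>t\<close> avoids the zeros of all these polynomials.\<close>
    then obtain t where t: "poly (q * (\<Prod>a<N. r a)) t \<noteq> 0" by (rule poly_nonzero_point)
    then have "D (X t a) \<noteq> 0" if "a < N" for a using that by (simp add: r poly_prod)
    then have "minor_det N (\<lambda>(x, y) w. G x y w) (\<lambda>a. (X t a, snd (ps a))) vs
        = minor_det N H (\<lambda>a. (X t a, snd (ps a))) vs"
      unfolding minor_det_def by (intro arg_cong[where f = det] eq_matI) (auto simp: H_def)
    also have "\<dots> = 0" unfolding N_def by (rule minor_det_eq_0[OF H])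
    finally show False using t by (simp add: q)
  qed
  then have "kernel_rank_le (s * A) (\<lambda>(x, y) w. G x y w)"
    unfolding N_def by (rule kernel_rank_leI_minor_det)
  then show ?thesis by (rule kernel_rank_le_mono) (simp add: \<open>s \<le> K\<close>)
qed

text \<open>Coordinates from \<open>i\<close> on are frozen at \<open>p\<close>, and freeing one
  more costs a factor \<open>K\<close>. The induction is for arbitrary \<open>p\<close> because its
  step uses the bound at \<open>p(i := y)\<close>.\<close>

lemma kernel_rank_le_coordinates:
  fixes G :: "(nat \<Rightarrow> 'c::field_char_0) \<Rightarrow> 'w \<Rightarrow> 'c"
  assumes poly: "\<And>w. poly_on_lines (\<lambda>x. G x w)"
    and lines: "\<And>p i. i < k \<Longrightarrow> kernel_rank_le K (\<lambda>t w. G (p(i := t)) w)"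
    and "i \<le> k"
  shows "kernel_rank_le (K ^ i) (\<lambda>x w. G (\<lambda>j. if j < i then x j else p j) w)"
  using \<open>i \<le> k\<close>
proof (induction i arbitrary: p)
  case 0
  show ?case by (rule kernel_rank_leI[where f = "\<lambda>_ _. 1" and g = "\<lambda>_ w. G p w"]) simp
next
  case (Suc i)
  define G' where "G' x y w = G (\<lambda>j. if j < i then x j else (p(i := y)) j) w" for x y w
  have "kernel_rank_le (K * K ^ i) (\<lambda>(x, y) w. G' x y w)"
  proof (rule kernel_rank_le_prod)
    show "poly_on_lines (\<lambda>x. G' x y w)" for y w
      unfolding poly_on_lines_def
    proof (intro allI)
      fix a b
      \<comment> \<open>Frozen coordinates get direction 0.\<close>
      have "\<exists>q. \<forall>t. G (\<lambda>j. (if j < i then a j else (p(i := y)) j) + t * (if j < i then b j else 0)) w = poly q t"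
        by (rule poly_on_linesD[OF poly])
      moreover have "(\<lambda>j. (if j < i then a j else (p(i := y)) j) + t * (if j < i then b j else 0))
        = (\<lambda>j. if j < i then a j + t * b j else (p(i := y)) j)" for t by auto
      ultimately show "\<exists>q. \<forall>t. G' (\<lambda>j. a j + t * b j) y w = poly q t" unfolding G'_def by simp
    qed
    show "kernel_rank_le (K ^ i) (\<lambda>x w. G' x y w)" for y
      unfolding G'_def using Suc by simp
    show "kernel_rank_le K (G' x)" for x
    proof -
      have "(\<lambda>j. if j < i then x j else (p(i := y)) j) = (\<lambda>j. if j < i then x j else p j)(i := y)" for y
        by auto
      then show ?thesis using lines[of i "\<lambda>j. if j < i then x j else p j"] Suc.prems
        unfolding G'_def by simp
    qed
  qed
  \<comment> \<open>Restriction to the pairs \<open>(x, x i)\<close> turns the independent parameter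
    \<open>y\<close> into coordinate \<open>i\<close> of \<open>x\<close>.\<close>
  from kernel_rank_le_precomp[OF this, where \<phi> = "\<lambda>x. (x, x i)" and \<psi> = "\<lambda>w. w"]
  have "kernel_rank_le (K * K ^ i) (\<lambda>x w. G' x (x i) w)" by simp
  moreover have "(\<lambda>j. if j < i then x j else (p(i := x i)) j) = (\<lambda>j. if j < Suc i then x j else p j)" for x
    by (auto simp: less_Suc_eq)
  ultimately show ?case unfolding G'_def by simp
qed

section \<open>Matrix ranks and images of injective matrices\<close>

text \<open>All columns are combinations of a maximal independent set of columns, whose size is the
  rank.\<close>

lemma (in vec_space) rank_factorization:
  assumes A: "A \<in> carrier_mat n nc"
  shows "\<exists>f g. \<forall>i<n. \<forall>j<nc. A $$ (i, j) = (\<Sum>s<rank A. f s i * g s j)"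
proof -
  let ?P = "\<lambda>T. T \<subseteq> set (cols A) \<and> lin_indpt T"
  obtain S where S: "maximal S ?P"
    using maximal_exists[of ?P "card (set (cols A))" "{}"]
    by (meson List.finite_set card_mono empty_iff empty_subsetI finite_lin_indpt2 rev_finite_subset)
  then have "S \<subseteq> set (cols A)" "lin_indpt S" unfolding maximal_def by blast+
  have fin: "finite S" using \<open>S \<subseteq> set (cols A)\<close> finite_subset by blast
  have carr: "S \<subseteq> carrier_vec n" using \<open>S \<subseteq> set (cols A)\<close> A cols_dim by blast
  have card: "card S = rank A" using rank_card_indpt[OF A S] by simp
  have "\<exists>a. c = lincomb a S" if c: "c \<in> set (cols A)" for c
  proof -
    have c': "c \<in> carrier_vec n" using c A cols_dim by blast
    have "c \<in> span S"
    proof (cases "c \<in> S")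
      case True
      then show ?thesis using span_mem carr by simp
    next
      case False
      have "lin_dep (S \<union> {c})"
      proof (rule ccontr)
        assume "lin_indpt (S \<union> {c})"
        then have "?P (S \<union> {c})" using \<open>S \<subseteq> set (cols A)\<close> c by blast
        then have "S \<union> {c} = S" using S unfolding maximal_def by blast
        with False show False by blast
      qed
      then show ?thesis using lin_dep_iff_in_span[of S c] carr c' False \<open>lin_indpt S\<close> by simp
    qed
    then show ?thesis using finite_span[OF fin] carr by auto
  qed
  then have "\<exists>a. \<forall>c\<in>set (cols A). c = lincomb (a c) S" by metis
  then obtain a where a: "\<And>c. c \<in> set (cols A) \<Longrightarrow> c = lincomb (a c) S" by blast
  obtain h where h: "bij_betw h {..<rank A} S"
    using ex_bij_betw_nat_finite[OF fin] card by (auto simp: atLeast0LessThan)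
  show ?thesis
  proof (intro exI allI impI)
    fix i j assume "i < n" "j < nc"
    then have "col A j \<in> set (cols A)" using A by (auto simp: cols_def)
    have "A $$ (i, j) = col A j $ i" using A \<open>i < n\<close> \<open>j < nc\<close> by simp
    also have "\<dots> = lincomb (a (col A j)) S $ i" using a[OF \<open>col A j \<in> set (cols A)\<close>] by simp
    also have "\<dots> = (\<Sum>x\<in>S. a (col A j) x * x $ i)" by (rule lincomb_index[OF \<open>i < n\<close> carr])
    also have "\<dots> = (\<Sum>s<rank A. a (col A j) (h s) * h s $ i)"
      using sum.reindex_bij_betw[OF h, of "\<lambda>x. a (col A j) x * x $ i"] by simp
    also have "\<dots> = (\<Sum>s<rank A. h s $ i * a (col A j) (h s))" by (simp add: mult.commute)
    finally show "A $$ (i, j) = (\<Sum>s<rank A. (\<lambda>s i. h s $ i) s i * (\<lambda>s j. a (col A j) (h s)) s j)"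
      by simp
  qed
qed

lemma (in vec_space) rank_le_factorization:
  "rank (mat n nc (\<lambda>(i, j). \<Sum>s<N. f s i * g s j)) \<le> N"
proof (induction N)
  case 0
  have "mat n nc (\<lambda>(i, j). \<Sum>s<0. f s i * g s j) = 0\<^sub>m n nc" by (rule eq_matI) auto
  then have "rank (mat n nc (\<lambda>(i, j). \<Sum>s<0. f s i * g s j)) = 0" by (simp only: rank_0I)
  then show ?case by (rule eq_imp_le)
next
  case (Suc N)
  let ?A = "mat n nc (\<lambda>(i, j). \<Sum>s<N. f s i * g s j)" and ?B = "mat n nc (\<lambda>(i, j). f N i * g N j)"
  have "mat n nc (\<lambda>(i, j). \<Sum>s<Suc N. f s i * g s j) = ?A + ?B" by (rule eq_matI) auto
  moreover have "rank (?A + ?B) \<le> rank ?A + rank ?B" by (rule rank_subadditive[of _ nc]) simp_all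
  moreover have "rank ?B \<le> 1" by (rule rank_le_1_product_entries[of _ nc "f N" "g N"]) simp_all
  ultimately show ?case using Suc by simp
qed

text \<open>By rank-nullity, since the kernel is trivial.\<close>

lemma image_in_grassmannian:
  assumes E: "E \<in> carrier_mat k l" and inj: "inj_on (\<lambda>v. E *\<^sub>v v) (carrier_vec l)"
  shows "(\<lambda>v. E *\<^sub>v v) ` carrier_vec l \<in> grassmannian l k"
proof -
  interpret V: vec_space "TYPE(complex)" l .
  interpret W: vec_space "TYPE(complex)" k .
  interpret T: linear_map class_ring "module_vec TYPE(complex) l" "module_vec TYPE(complex) k" "\<lambda>v. E *\<^sub>v v"
    using E by unfold_locales
      (auto simp: LinearCombinations.module_hom_def module_vec_simps mult_add_distrib_mat_vec mult_mat_vec)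
  have im: "T.imT = (\<lambda>v. E *\<^sub>v v) ` carrier_vec l" by (simp add: T.im_def)
  have "vectorspace.dim class_ring (W.vs T.imT) + vectorspace.dim class_ring (V.vs T.kerT) = V.dim"
    by (rule T.rank_nullity) (rule V.fin_dim)
  moreover have "vectorspace.dim class_ring (V.vs T.kerT) = 0"
    by (rule T.inj_imp_dim_ker0) (simp add: inj)
  ultimately show ?thesis
    using T.imT_is_subspace im V.dim_is_n unfolding grassmannian_def by simp
qed

section \<open>Polarized evaluation\<close>

text \<open>The product runs over the keys, so no number of variables has to be carried
  along.\<close>

definition multi_power :: "(nat \<Rightarrow> complex) \<Rightarrow> multiindex \<Rightarrow> complex" where
  "multi_power z \<alpha> = (\<Prod>i\<in>Poly_Mapping.keys \<alpha>. z i ^ Poly_Mapping.lookup \<alpha> i)"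

text \<open>The polynomial with \<open>z\<close> and \<open>\<bar>z\<close> evaluated at two unrelated points.\<close>

definition polarized :: "zzbar_poly \<Rightarrow> (nat \<Rightarrow> complex) \<Rightarrow> (nat \<Rightarrow> complex) \<Rightarrow> complex" where
  "polarized r z w =
     (\<Sum>p\<in>Poly_Mapping.keys r. Poly_Mapping.lookup r p * multi_power z (fst p) * multi_power w (snd p))"

lemma multi_power_superset:
  assumes "finite S" "Poly_Mapping.keys \<alpha> \<subseteq> S"
  shows "multi_power z \<alpha> = (\<Prod>i\<in>S. z i ^ Poly_Mapping.lookup \<alpha> i)"
  unfolding multi_power_def using assms
  by (intro prod.mono_neutral_left) (auto simp: in_keys_iff)

lemma multi_power_0 [simp]: "multi_power z 0 = 1"
  by (simp add: multi_power_def)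

lemma multi_power_single [simp]: "multi_power z (Poly_Mapping.single j 1) = z j"
  by (simp add: multi_power_def)

lemma multi_power_add: "multi_power z (\<alpha> + \<beta>) = multi_power z \<alpha> * multi_power z \<beta>"
proof -
  let ?S = "Poly_Mapping.keys \<alpha> \<union> Poly_Mapping.keys \<beta>"
  have "multi_power z (\<alpha> + \<beta>) = (\<Prod>i\<in>?S. z i ^ Poly_Mapping.lookup (\<alpha> + \<beta>) i)"
    by (rule multi_power_superset) (use Poly_Mapping.keys_add[of \<alpha> \<beta>] in auto)
  also have "\<dots> = (\<Prod>i\<in>?S. z i ^ Poly_Mapping.lookup \<alpha> i) * (\<Prod>i\<in>?S. z i ^ Poly_Mapping.lookup \<beta> i)"
    by (simp add: lookup_add power_add prod.distrib)
  also have "\<dots> = multi_power z \<alpha> * multi_power z \<beta>"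
    by (simp add: multi_power_superset[of ?S])
  finally show ?thesis .
qed

lemma polarized_superset:
  assumes "finite S" "Poly_Mapping.keys r \<subseteq> S"
  shows "polarized r z w =
    (\<Sum>p\<in>S. Poly_Mapping.lookup r p * multi_power z (fst p) * multi_power w (snd p))"
  unfolding polarized_def using assms
  by (intro sum.mono_neutral_left) (auto simp: in_keys_iff)

lemma polarized_0 [simp]: "polarized 0 z w = 0"
  by (simp add: polarized_def)

lemma polarized_single:
  "polarized (Poly_Mapping.single p c) z w = c * multi_power z (fst p) * multi_power w (snd p)"
  by (simp add: polarized_def)

lemma polarized_add: "polarized (p + q) z w = polarized p z w + polarized q z w"
proof -
  let ?S = "Poly_Mapping.keys p \<union> Poly_Mapping.keys q"
  have "polarized (p + q) z w =
      (\<Sum>x\<in>?S. Poly_Mapping.lookup (p + q) x * multi_power z (fst x) * multi_power w (snd x))"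
    by (rule polarized_superset) (use Poly_Mapping.keys_add[of p q] in auto)
  also have "\<dots> = polarized p z w + polarized q z w"
    by (simp add: polarized_superset[of ?S] lookup_add algebra_simps sum.distrib)
  finally show ?thesis .
qed

lemma polarized_sum: "polarized (\<Sum>i\<in>I. f i) z w = (\<Sum>i\<in>I. polarized (f i) z w)"
  by (induction I rule: infinite_finite_induct) (simp_all add: polarized_add)

lemma sum_single_keys: "(\<Sum>k\<in>Poly_Mapping.keys p. Poly_Mapping.single k (Poly_Mapping.lookup p k)) = p"
proof (rule poly_mapping_eqI)
  fix k
  show "Poly_Mapping.lookup (\<Sum>k\<in>Poly_Mapping.keys p. Poly_Mapping.single k (Poly_Mapping.lookup p k)) k
      = Poly_Mapping.lookup p k"
    by (simp add: lookup_sum lookup_single when_def in_keys_iff)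
qed

lemma polarized_mult: "polarized (p * q) z w = polarized p z w * polarized q z w"
proof -
  let ?s = "\<lambda>p k. Poly_Mapping.single k (Poly_Mapping.lookup p k) :: zzbar_poly"
  have "p * q = (\<Sum>k\<in>Poly_Mapping.keys p. ?s p k) * (\<Sum>l\<in>Poly_Mapping.keys q. ?s q l)"
    by (simp only: sum_single_keys)
  also have "\<dots> = (\<Sum>k\<in>Poly_Mapping.keys p. \<Sum>l\<in>Poly_Mapping.keys q. ?s p k * ?s q l)"
    by (rule sum_product)
  finally have "polarized (p * q) z w =
      (\<Sum>k\<in>Poly_Mapping.keys p. \<Sum>l\<in>Poly_Mapping.keys q. polarized (?s p k * ?s q l) z w)"
    by (simp only: polarized_sum)
  also have "\<dots> = polarized p z w * polarized q z w"
    unfolding polarized_def[of p] polarized_def[of q] sum_product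
    by (intro sum.cong refl) (simp add: mult_single polarized_single multi_power_add mult_ac)
  finally show ?thesis .
qed

lemma polarized_const [simp]: "polarized (const_poly c) z w = c"
  by (simp add: const_poly_def polarized_single)

lemma polarized_1 [simp]: "polarized 1 z w = 1"
  using polarized_const[of 1] by (simp add: const_poly_def)

lemma polarized_z_var [simp]: "polarized (z_var j) z w = z j"
  unfolding z_var_def polarized_single by (simp only: fst_conv snd_conv multi_power_single multi_power_0) simp

lemma polarized_zbar_var [simp]: "polarized (zbar_var j) z w = w j"
  unfolding zbar_var_def polarized_single by (simp only: fst_conv snd_conv multi_power_single multi_power_0) simp

lemma polarized_prod: "polarized (\<Prod>i\<in>I. f i) z w = (\<Prod>i\<in>I. polarized (f i) z w)"
  by (induction I rule: infinite_finite_induct) (simp_all add: polarized_mult)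

lemma polarized_power: "polarized (p ^ n) z w = polarized p z w ^ n"
  by (induction n) (simp_all add: polarized_mult)

text \<open>Evaluation at a pair of points is a ring homomorphism; bihomogeneity confines the
  exponents to the variables below \<open>k\<close>, over which \<open>compose_linear\<close> takes
  its products.\<close>

lemma polarized_compose_linear:
  assumes r: "bihomogeneous k d r" and E: "dim_row E = k"
  shows "polarized (compose_linear r E) z w =
    polarized r (\<lambda>i. \<Sum>j<dim_col E. E $$ (i, j) * z j) (\<lambda>i. \<Sum>j<dim_col E. cnj (E $$ (i, j)) * w j)"
proof -
  have keys: "Poly_Mapping.keys (fst p) \<subseteq> {..<k}" "Poly_Mapping.keys (snd p) \<subseteq> {..<k}"
    if "p \<in> Poly_Mapping.keys r" for p
    using r that unfolding bihomogeneous_def multiindices_def by (fastforce simp: split_beta)+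
  have "polarized (compose_linear r E) z w = (\<Sum>p\<in>Poly_Mapping.keys r. Poly_Mapping.lookup r p
      * (\<Prod>i<k. (\<Sum>j<dim_col E. E $$ (i, j) * z j) ^ Poly_Mapping.lookup (fst p) i)
      * (\<Prod>i<k. (\<Sum>j<dim_col E. cnj (E $$ (i, j)) * w j) ^ Poly_Mapping.lookup (snd p) i))"
    unfolding compose_linear_def E polarized_sum
    by (intro sum.cong refl)
      (simp add: split_beta polarized_mult polarized_prod polarized_power polarized_sum)
  also have "\<dots> = polarized r (\<lambda>i. \<Sum>j<dim_col E. E $$ (i, j) * z j)
      (\<lambda>i. \<Sum>j<dim_col E. cnj (E $$ (i, j)) * w j)"
    unfolding polarized_def
    by (intro sum.cong refl) (simp add: multi_power_superset[of "{..<k}"] keys)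
  finally show ?thesis .
qed

section \<open>Degrees under linear substitution\<close>

text \<open>The two degrees are kept apart because each factor of a substituted monomial involves
  only one group of variables.\<close>

definition bidegree :: "nat \<Rightarrow> nat \<Rightarrow> nat \<Rightarrow> zzbar_poly \<Rightarrow> bool" where
  "bidegree l a b p \<longleftrightarrow> Poly_Mapping.keys p \<subseteq> multiindices l a \<times> multiindices l b"

lemma bihomogeneous_iff_bidegree: "bihomogeneous l d p \<longleftrightarrow> bidegree l d d p"
  unfolding bihomogeneous_def bidegree_def by auto

lemma multiindices_0: "0 \<in> multiindices l 0"
  by (simp add: multiindices_def)

lemma multiindices_single: "j < l \<Longrightarrow> Poly_Mapping.single j 1 \<in> multiindices l 1"
  by (simp add: multiindices_def lookup_single when_def)

lemma multiindices_add:
  assumes "\<alpha> \<in> multiindices l a" "\<beta> \<in> multiindices l b"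
  shows "\<alpha> + \<beta> \<in> multiindices l (a + b)"
  using assms Poly_Mapping.keys_add[of \<alpha> \<beta>]
  unfolding multiindices_def by (auto simp: lookup_add sum.distrib)

lemma bidegree_mult:
  assumes "bidegree l a b p" "bidegree l a' b' q"
  shows "bidegree l (a + a') (b + b') (p * q)"
  unfolding bidegree_def
proof
  fix x assume "x \<in> Poly_Mapping.keys (p * q)"
  then obtain u v where "x = u + v" "u \<in> Poly_Mapping.keys p" "v \<in> Poly_Mapping.keys q"
    using Poly_Mapping.keys_mult[of p q] by blast
  moreover from this have "fst u \<in> multiindices l a" "snd u \<in> multiindices l b"
      "fst v \<in> multiindices l a'" "snd v \<in> multiindices l b'"
    using assms unfolding bidegree_def by auto
  ultimately show "x \<in> multiindices l (a + a') \<times> multiindices l (b + b')"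
    by (auto simp: mem_Times_iff multiindices_add)
qed

lemma bidegree_sum:
  assumes "\<And>i. i \<in> I \<Longrightarrow> bidegree l a b (f i)"
  shows "bidegree l a b (\<Sum>i\<in>I. f i)"
  using assms Poly_Mapping.keys_sum[of f I] unfolding bidegree_def by blast

lemma bidegree_const: "bidegree l 0 0 (const_poly c)"
  by (simp add: bidegree_def const_poly_def zero_prod_def multiindices_0)

lemma bidegree_1: "bidegree l 0 0 1"
  using bidegree_const[of l 1] by (simp add: const_poly_def)

lemma bidegree_power:
  assumes "bidegree l a b p"
  shows "bidegree l (n * a) (n * b) (p ^ n)"
  using assms by (induction n) (auto simp: bidegree_1 intro: bidegree_mult)

lemma bidegree_prod:
  assumes "finite I" "\<And>i. i \<in> I \<Longrightarrow> bidegree l (a i) (b i) (f i)"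
  shows "bidegree l (\<Sum>i\<in>I. a i) (\<Sum>i\<in>I. b i) (\<Prod>i\<in>I. f i)"
  using assms by (induction I rule: finite_induct) (auto simp: bidegree_1 intro: bidegree_mult)

lemma bidegree_linear_z: "bidegree l 1 0 (\<Sum>j<l. const_poly (c j) * z_var j)"
proof (rule bidegree_sum)
  fix j assume "j \<in> {..<l}"
  then have "bidegree l 1 0 (z_var j)"
    using multiindices_single[of j l] by (simp add: bidegree_def z_var_def multiindices_0)
  from bidegree_mult[OF bidegree_const this] show "bidegree l 1 0 (const_poly (c j) * z_var j)" by simp
qed

lemma bidegree_linear_zbar: "bidegree l 0 1 (\<Sum>j<l. const_poly (c j) * zbar_var j)"
proof (rule bidegree_sum)
  fix j assume "j \<in> {..<l}"
  then have "bidegree l 0 1 (zbar_var j)"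
    using multiindices_single[of j l] by (simp add: bidegree_def zbar_var_def multiindices_0)
  from bidegree_mult[OF bidegree_const this] show "bidegree l 0 1 (const_poly (c j) * zbar_var j)" by simp
qed

lemma bihomogeneous_compose_linear:
  assumes r: "bihomogeneous k d r" and E: "E \<in> carrier_mat k l"
  shows "bihomogeneous l d (compose_linear r E)"
  unfolding bihomogeneous_iff_bidegree compose_linear_def
proof (rule bidegree_sum)
  fix p assume "p \<in> Poly_Mapping.keys r"
  then obtain \<alpha> \<beta> where p: "p = (\<alpha>, \<beta>)" and ab: "\<alpha> \<in> multiindices k d" "\<beta> \<in> multiindices k d"
    using r unfolding bihomogeneous_def by auto
  let ?z = "\<lambda>i. (\<Sum>j<l. const_poly (E $$ (i, j)) * z_var j) ^ Poly_Mapping.lookup \<alpha> i"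
  let ?w = "\<lambda>i. (\<Sum>j<l. const_poly (cnj (E $$ (i, j))) * zbar_var j) ^ Poly_Mapping.lookup \<beta> i"
  have "bidegree l (\<Sum>i<k. Poly_Mapping.lookup \<alpha> i) (\<Sum>i<k. 0) (\<Prod>i<k. ?z i)"
    by (rule bidegree_prod)
      (use bidegree_power[OF bidegree_linear_z] in auto)
  moreover have "bidegree l (\<Sum>i<k. 0) (\<Sum>i<k. Poly_Mapping.lookup \<beta> i) (\<Prod>i<k. ?w i)"
    by (rule bidegree_prod)
      (use bidegree_power[OF bidegree_linear_zbar] in auto)
  ultimately have "bidegree l (0 + d + 0) (0 + 0 + d)
      (const_poly (Poly_Mapping.lookup r (\<alpha>, \<beta>)) * (\<Prod>i<k. ?z i) * (\<Prod>i<k. ?w i))"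
    using ab by (intro bidegree_mult bidegree_const) (simp_all add: multiindices_def)
  then show "bidegree l d d (case p of (\<alpha>, \<beta>) \<Rightarrow> const_poly (Poly_Mapping.lookup r (\<alpha>, \<beta>))
      * (\<Prod>i<dim_row E. (\<Sum>j<dim_col E. const_poly (E $$ (i, j)) * z_var j) ^ Poly_Mapping.lookup \<alpha> i)
      * (\<Prod>i<dim_row E. (\<Sum>j<dim_col E. const_poly (cnj (E $$ (i, j))) * zbar_var j) ^ Poly_Mapping.lookup \<beta> i))"
    using E p by simp
qed

section \<open>Rank of the coefficient matrix\<close>

text \<open>Lagrange interpolation at \<open>d + 1\<close> points: in degree at most
  \<open>d\<close>, coefficient \<open>j\<close> is a linear combination of values, weighted by the
  \<open>j\<close>-th coefficients of the basis polynomials \<open>L t\<close>.\<close>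

lemma ex_coefficient_functional:
  "\<exists>(T :: 'c::field_char_0 set) u. finite T \<and>
     (\<forall>e\<le>d. \<forall>j\<le>d. (\<Sum>t\<in>T. u j t * t ^ e) = (if e = j then 1 else 0))"
proof -
  define T :: "'c set" where "T = of_nat ` {..d}"
  have T: "finite T" "card T = Suc d" by (auto simp: T_def card_image inj_on_def)
  define L where "L t = Polynomial.smult (inverse (\<Prod>s\<in>T - {t}. t - s)) (\<Prod>s\<in>T - {t}. [:- s, 1:])" for t
  have L: "poly (L t) x = (if x = t then 1 else 0)" if "t \<in> T" "x \<in> T" for t x
    using that T by (auto simp: L_def poly_prod prod_zero_iff)
  have deg_L: "degree (L t) \<le> d" if "t \<in> T" for t
  proof -
    have "degree (\<Prod>s\<in>T - {t}. [:- s, 1:]) \<le> sum (degree \<circ> (\<lambda>s. [:- s, 1:])) (T - {t})"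
      using T by (intro degree_prod_sum_le) simp
    also have "\<dots> = d" using T that by simp
    finally show ?thesis unfolding L_def using degree_smult_le order_trans by blast
  qed
  have interp: "(\<Sum>t\<in>T. Polynomial.smult (t ^ e) (L t)) = Polynomial.monom 1 e" if "e \<le> d" for e
  proof (rule poly_eqI_degree[of T])
    fix x assume "x \<in> T"
    have "poly (\<Sum>t\<in>T. Polynomial.smult (t ^ e) (L t)) x = (\<Sum>t\<in>T. if x = t then t ^ e else 0)"
      unfolding poly_sum using L[OF _ \<open>x \<in> T\<close>] by (intro sum.cong) auto
    also have "\<dots> = poly (Polynomial.monom 1 e) x" using T \<open>x \<in> T\<close> by (simp add: poly_monom)
    finally show "poly (\<Sum>t\<in>T. Polynomial.smult (t ^ e) (L t)) x = poly (Polynomial.monom 1 e) x" .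
  next
    have "degree (\<Sum>t\<in>T. Polynomial.smult (t ^ e) (L t)) \<le> d"
      using T deg_L by (intro degree_sum_le) (auto intro: order_trans[OF degree_smult_le])
    then show "degree (\<Sum>t\<in>T. Polynomial.smult (t ^ e) (L t)) < card T" using T by simp
    show "degree (Polynomial.monom (1::'c) e) < card T" using T that by (simp add: degree_monom_eq)
  qed
  have "(\<Sum>t\<in>T. Polynomial.coeff (L t) j * t ^ e) = (if e = j then 1 else 0)" if "e \<le> d" for e j
  proof -
    have "(\<Sum>t\<in>T. Polynomial.coeff (L t) j * t ^ e) = Polynomial.coeff (\<Sum>t\<in>T. Polynomial.smult (t ^ e) (L t)) j"
      by (simp add: coeff_sum mult.commute)
    then show ?thesis by (simp add: interp that)
  qed
  then show ?thesis using T by (intro exI[of _ T] exI[of _ "\<lambda>j t. Polynomial.coeff (L t) j"]) simp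
qed

lemma multiindices_lookup_le:
  assumes "\<alpha> \<in> multiindices k d" "i < k"
  shows "Poly_Mapping.lookup \<alpha> i \<le> d"
  using member_le_sum[of i "{..<k}" "Poly_Mapping.lookup \<alpha>"] assms by (simp add: multiindices_def)

lemma multiindices_eqI:
  assumes "\<alpha> \<in> multiindices k d" "\<beta> \<in> multiindices k d"
    and eq: "\<And>i. i < k \<Longrightarrow> Poly_Mapping.lookup \<alpha> i = Poly_Mapping.lookup \<beta> i"
  shows "\<alpha> = \<beta>"
proof (rule poly_mapping_eqI)
  fix i
  show "Poly_Mapping.lookup \<alpha> i = Poly_Mapping.lookup \<beta> i"
  proof (cases "i < k")
    case False
    then have "i \<notin> Poly_Mapping.keys \<alpha>" "i \<notin> Poly_Mapping.keys \<beta>"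
      using assms(1,2) unfolding multiindices_def by auto
    then show ?thesis by (simp add: in_keys_iff)
  qed (rule eq)
qed

text \<open>Product of the one-variable functionals over a grid; in total degree \<open>d\<close>
  every single exponent is at most \<open>d\<close>.\<close>

lemma ex_multi_coefficient_functional:
  "\<exists>Z v. finite Z \<and> (\<forall>\<alpha>\<in>multiindices k d. \<forall>\<beta>\<in>multiindices k d.
     (\<Sum>z\<in>Z. v \<alpha> z * multi_power z \<beta>) = (if \<alpha> = \<beta> then 1 else 0))"
proof -
  obtain T :: "complex set" and u where T: "finite T"
    and u: "\<And>e j. e \<le> d \<Longrightarrow> j \<le> d \<Longrightarrow> (\<Sum>t\<in>T. u j t * t ^ e) = (if e = j then 1 else 0)"
    using ex_coefficient_functional[of d, where 'c = complex] by blast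
  \<comment> \<open>Grid points are \<open>undefined\<close> from index \<open>k\<close> on, where
    the monomials have no variables.\<close>
  define Z where "Z = PiE {..<k} (\<lambda>_. T)"
  define v where "v \<alpha> z = (\<Prod>i<k. u (Poly_Mapping.lookup \<alpha> i) (z i))" for \<alpha> z
  have "(\<Sum>z\<in>Z. v \<alpha> z * multi_power z \<beta>) = (if \<alpha> = \<beta> then 1 else 0)"
    if \<alpha>: "\<alpha> \<in> multiindices k d" and \<beta>: "\<beta> \<in> multiindices k d" for \<alpha> \<beta>
  proof -
    have "Poly_Mapping.keys \<beta> \<subseteq> {..<k}" using \<beta> by (simp add: multiindices_def)
    then have "(\<Sum>z\<in>Z. v \<alpha> z * multi_power z \<beta>) =
        (\<Sum>z\<in>Z. \<Prod>i<k. u (Poly_Mapping.lookup \<alpha> i) (z i) * z i ^ Poly_Mapping.lookup \<beta> i)"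
      by (simp add: v_def multi_power_superset[of "{..<k}"] prod.distrib)
    also have "\<dots> = (\<Prod>i<k. \<Sum>t\<in>T. u (Poly_Mapping.lookup \<alpha> i) t * t ^ Poly_Mapping.lookup \<beta> i)"
      unfolding Z_def using T by (subst prod_sum_PiE) auto
    also have "\<dots> = (\<Prod>i<k. if Poly_Mapping.lookup \<beta> i = Poly_Mapping.lookup \<alpha> i then 1 else 0)"
      by (intro prod.cong refl u) (auto intro: multiindices_lookup_le[OF \<alpha>] multiindices_lookup_le[OF \<beta>])
    also have "\<dots> = (if \<alpha> = \<beta> then 1 else 0)"
    proof (cases "\<alpha> = \<beta>")
      case False
      then obtain i where "i < k" "Poly_Mapping.lookup \<beta> i \<noteq> Poly_Mapping.lookup \<alpha> i"
        using multiindices_eqI[OF \<alpha> \<beta>] by metis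
      then show ?thesis using False by (auto simp: prod_zero_iff)
    qed simp
    finally show ?thesis .
  qed
  moreover have "finite Z" unfolding Z_def using T by (intro finite_PiE) auto
  ultimately show ?thesis by blast
qed

lemma polarized_bihomogeneous:
  assumes "bihomogeneous k d r"
  shows "polarized r z w = (\<Sum>\<alpha>\<in>multiindices k d. \<Sum>\<beta>\<in>multiindices k d.
           Poly_Mapping.lookup r (\<alpha>, \<beta>) * multi_power z \<alpha> * multi_power w \<beta>)"
proof -
  have "polarized r z w = (\<Sum>p\<in>multiindices k d \<times> multiindices k d.
      Poly_Mapping.lookup r p * multi_power z (fst p) * multi_power w (snd p))"
    using assms by (intro polarized_superset)
      (auto simp: finite_multiindices bihomogeneous_iff_bidegree bidegree_def)
  then show ?thesis by (simp add: sum.cartesian_product split_beta)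
qed

lemma coeff_mat_eq:
  "coeff_mat k d r = mat (card (multiindices k d)) (card (multiindices k d))
     (\<lambda>(i, j). Poly_Mapping.lookup r (sorted_list_of_set (multiindices k d) ! i,
                                      sorted_list_of_set (multiindices k d) ! j))"
  by (simp add: coeff_mat_def Let_def)

text \<open>A factorization of the coefficient matrix, summed against the monomials in both
  arguments, factors the kernel.\<close>

lemma kernel_rank_le_polarized:
  assumes r: "bihomogeneous k d r" and rank: "poly_rank k d r \<le> K"
  shows "kernel_rank_le K (polarized r)"
proof -
  let ?M = "multiindices k d" and ?D = "card (multiindices k d)"
  let ?as = "sorted_list_of_set (multiindices k d)"
  interpret vec_space "TYPE(complex)" ?D .
  have bij: "bij_betw (\<lambda>i. ?as ! i) {..<?D} ?M"
    using bij_betw_nth[of ?as "{..<?D}" ?M] finite_multiindices[of k d] by simp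
  obtain f g where fg: "\<And>i j. i < ?D \<Longrightarrow> j < ?D \<Longrightarrow>
      Poly_Mapping.lookup r (?as ! i, ?as ! j) = (\<Sum>s<poly_rank k d r. f s i * g s j)"
    using rank_factorization[of "coeff_mat k d r" ?D]
    unfolding coeff_mat_eq poly_rank_def by auto
  have "kernel_rank_le (poly_rank k d r) (polarized r)"
  proof (rule kernel_rank_leI[where f = "\<lambda>s z. \<Sum>i<?D. f s i * multi_power z (?as ! i)"
        and g = "\<lambda>s w. \<Sum>j<?D. g s j * multi_power w (?as ! j)"])
    fix z w
    have "polarized r z w = (\<Sum>i<?D. \<Sum>j<?D.
        Poly_Mapping.lookup r (?as ! i, ?as ! j) * multi_power z (?as ! i) * multi_power w (?as ! j))"
      unfolding polarized_bihomogeneous[OF r] sum.reindex_bij_betw[OF bij, symmetric] by simp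
    also have "\<dots> = (\<Sum>i<?D. \<Sum>j<?D. \<Sum>s<poly_rank k d r.
        (f s i * multi_power z (?as ! i)) * (g s j * multi_power w (?as ! j)))"
      by (intro sum.cong refl) (simp add: fg sum_distrib_left sum_distrib_right mult_ac)
    also have "\<dots> = (\<Sum>i<?D. \<Sum>s<poly_rank k d r. \<Sum>j<?D.
        (f s i * multi_power z (?as ! i)) * (g s j * multi_power w (?as ! j)))"
      by (intro sum.cong refl sum.swap)
    also have "\<dots> = (\<Sum>s<poly_rank k d r. \<Sum>i<?D. \<Sum>j<?D.
        (f s i * multi_power z (?as ! i)) * (g s j * multi_power w (?as ! j)))"
      by (rule sum.swap)
    finally show "polarized r z w = (\<Sum>s<poly_rank k d r. (\<Sum>i<?D. f s i * multi_power z (?as ! i))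
        * (\<Sum>j<?D. g s j * multi_power w (?as ! j)))"
      by (simp add: sum_product)
  qed
  then show ?thesis using rank by (rule kernel_rank_le_mono)
qed

text \<open>Applying the coefficient functionals in both arguments turns a factorization by
  arbitrary functions into one of the coefficient matrix.\<close>

lemma poly_rank_le_kernel_rank:
  assumes r: "bihomogeneous k d r" and rank: "kernel_rank_le N (polarized r)"
  shows "poly_rank k d r \<le> N"
proof -
  let ?M = "multiindices k d" and ?D = "card (multiindices k d)"
  let ?as = "sorted_list_of_set (multiindices k d)"
  interpret vec_space "TYPE(complex)" ?D .
  obtain Z v where Z: "finite Z" and v: "\<And>\<alpha> \<beta>. \<alpha> \<in> ?M \<Longrightarrow> \<beta> \<in> ?M \<Longrightarrow>
      (\<Sum>z\<in>Z. v \<alpha> z * multi_power z \<beta>) = (if \<alpha> = \<beta> then 1 else 0)"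
    using ex_multi_coefficient_functional[of k d] by blast
  obtain f g where fg: "\<And>z w. polarized r z w = (\<Sum>s<N. f s z * g s w)"
    using rank unfolding kernel_rank_le_def by blast
  define F where "F s \<alpha> = (\<Sum>z\<in>Z. v \<alpha> z * f s z)" for s \<alpha>
  define G where "G s \<beta> = (\<Sum>w\<in>Z. v \<beta> w * g s w)" for s \<beta>
  have lookup: "Poly_Mapping.lookup r (\<alpha>, \<beta>) = (\<Sum>s<N. F s \<alpha> * G s \<beta>)"
    if \<alpha>: "\<alpha> \<in> ?M" and \<beta>: "\<beta> \<in> ?M" for \<alpha> \<beta>
  proof -
    let ?c = "\<lambda>\<alpha>' \<beta>'. Poly_Mapping.lookup r (\<alpha>', \<beta>')"
    have inner: "(\<Sum>z\<in>Z. v \<alpha> z * polarized r z w) = (\<Sum>\<beta>'\<in>?M. ?c \<alpha> \<beta>' * multi_power w \<beta>')" for w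
    proof -
      have "(\<Sum>z\<in>Z. v \<alpha> z * polarized r z w) =
          (\<Sum>z\<in>Z. \<Sum>\<alpha>'\<in>?M. (v \<alpha> z * multi_power z \<alpha>') * (\<Sum>\<beta>'\<in>?M. ?c \<alpha>' \<beta>' * multi_power w \<beta>'))"
        by (simp add: polarized_bihomogeneous[OF r] sum_distrib_left mult_ac)
      also have "\<dots> = (\<Sum>\<alpha>'\<in>?M. (\<Sum>z\<in>Z. v \<alpha> z * multi_power z \<alpha>')
          * (\<Sum>\<beta>'\<in>?M. ?c \<alpha>' \<beta>' * multi_power w \<beta>'))"
        by (subst sum.swap) (simp add: sum_distrib_right)
      also have "\<dots> = (\<Sum>\<alpha>'\<in>?M. if \<alpha> = \<alpha>' then \<Sum>\<beta>'\<in>?M. ?c \<alpha>' \<beta>' * multi_power w \<beta>' else 0)"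
        using \<alpha> by (intro sum.cong refl) (simp add: v)
      also have "\<dots> = (\<Sum>\<beta>'\<in>?M. ?c \<alpha> \<beta>' * multi_power w \<beta>')"
        using \<alpha> by (simp add: finite_multiindices)
      finally show ?thesis .
    qed
    have "(\<Sum>w\<in>Z. v \<beta> w * (\<Sum>z\<in>Z. v \<alpha> z * polarized r z w)) =
        (\<Sum>w\<in>Z. \<Sum>\<beta>'\<in>?M. ?c \<alpha> \<beta>' * (v \<beta> w * multi_power w \<beta>'))"
      by (simp add: inner sum_distrib_left mult_ac)
    also have "\<dots> = (\<Sum>\<beta>'\<in>?M. ?c \<alpha> \<beta>' * (\<Sum>w\<in>Z. v \<beta> w * multi_power w \<beta>'))"
      by (subst sum.swap) (simp add: sum_distrib_left)
    also have "\<dots> = (\<Sum>\<beta>'\<in>?M. if \<beta> = \<beta>' then ?c \<alpha> \<beta>' else 0)"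
      using \<beta> by (intro sum.cong refl) (simp add: v)
    also have "\<dots> = ?c \<alpha> \<beta>" using \<beta> by (simp add: finite_multiindices)
    finally have "?c \<alpha> \<beta> = (\<Sum>w\<in>Z. v \<beta> w * (\<Sum>z\<in>Z. v \<alpha> z * (\<Sum>s<N. f s z * g s w)))"
      by (simp add: fg)
    also have "\<dots> = (\<Sum>w\<in>Z. \<Sum>z\<in>Z. \<Sum>s<N. (v \<alpha> z * f s z) * (v \<beta> w * g s w))"
      by (simp add: sum_distrib_left mult_ac)
    also have "\<dots> = (\<Sum>w\<in>Z. \<Sum>s<N. \<Sum>z\<in>Z. (v \<alpha> z * f s z) * (v \<beta> w * g s w))"
      by (intro sum.cong refl sum.swap)
    also have "\<dots> = (\<Sum>s<N. \<Sum>w\<in>Z. \<Sum>z\<in>Z. (v \<alpha> z * f s z) * (v \<beta> w * g s w))"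
      by (rule sum.swap)
    also have "\<dots> = (\<Sum>s<N. \<Sum>z\<in>Z. \<Sum>w\<in>Z. (v \<alpha> z * f s z) * (v \<beta> w * g s w))"
      by (intro sum.cong refl sum.swap)
    finally show ?thesis by (simp add: F_def G_def sum_product)
  qed
  have in_M: "?as ! i \<in> ?M" if "i < ?D" for i
    using that nth_mem[of i ?as] finite_multiindices[of k d] by simp
  have "coeff_mat k d r = mat ?D ?D (\<lambda>(i, j). \<Sum>s<N. F s (?as ! i) * G s (?as ! j))"
    unfolding coeff_mat_eq by (rule eq_matI) (auto simp: lookup in_M)
  then show ?thesis
    using rank_le_factorization[where nc = ?D and N = N and f = "\<lambda>s i. F s (?as ! i)" and g = "\<lambda>s j. G s (?as ! j)"]
    by (simp add: poly_rank_def)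
qed

section \<open>Independence of the two linear substitutions\<close>

lemma polarized_cong:
  assumes r: "bihomogeneous k d r"
    and "\<And>i. i < k \<Longrightarrow> z i = z' i" "\<And>i. i < k \<Longrightarrow> w i = w' i"
  shows "polarized r z w = polarized r z' w'"
proof -
  have "multi_power z \<alpha> = multi_power z' \<alpha>" "multi_power w \<alpha> = multi_power w' \<alpha>"
    if "\<alpha> \<in> multiindices k d" for \<alpha>
    using that assms(2,3) unfolding multi_power_def multiindices_def by (auto intro!: prod.cong)
  then show ?thesis by (simp add: polarized_bihomogeneous[OF r])
qed

lemma polarized_line:
  "\<exists>p. \<forall>t. polarized r (\<lambda>i. a i + t * b i) (\<lambda>i. a' i + t * b' i) = poly p t"
proof (intro exI allI)
  fix t
  show "polarized r (\<lambda>i. a i + t * b i) (\<lambda>i. a' i + t * b' i) =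
    poly (\<Sum>p\<in>Poly_Mapping.keys r. Polynomial.smult (Poly_Mapping.lookup r p)
      ((\<Prod>i\<in>Poly_Mapping.keys (fst p). [:a i, b i:] ^ Poly_Mapping.lookup (fst p) i) *
       (\<Prod>i\<in>Poly_Mapping.keys (snd p). [:a' i, b' i:] ^ Poly_Mapping.lookup (snd p) i))) t"
    by (simp add: polarized_def multi_power_def poly_sum poly_prod mult.assoc)
qed

definition lin_app :: "nat \<Rightarrow> (nat \<Rightarrow> nat \<Rightarrow> complex) \<Rightarrow> (nat \<Rightarrow> complex) \<Rightarrow> nat \<Rightarrow> complex" where
  "lin_app l E x = (\<lambda>i. \<Sum>c<l. E i c * x c)"

lemma lin_app_line:
  "lin_app l (\<lambda>i c. E i c + t * E' i c) x = (\<lambda>i. lin_app l E x i + t * lin_app l E' x i)"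
  by (simp add: lin_app_def fun_eq_iff algebra_simps sum.distrib sum_distrib_left)

text \<open>The restriction rank refers to a chosen parametrization \<open>A\<close> of the image of
  \<open>E\<close>. As the images agree, \<open>E\<close> applied to \<open>x\<close> is
  \<open>A\<close> applied to some \<open>v x\<close>, and substituting any map \<open>v\<close>
  preserves the bound.\<close>

lemma kernel_rank_le_injective:
  assumes r: "bihomogeneous k d r"
    and ranks: "\<And>L. L \<in> grassmannian l k \<Longrightarrow> restriction_rank l k d r L \<le> K"
    and inj: "inj_on (\<lambda>v. mat k l (\<lambda>(i, c). E i c) *\<^sub>v v) (carrier_vec l)"
  shows "kernel_rank_le K (\<lambda>x y. polarized r (lin_app l E x) (lin_app l (\<lambda>i c. cnj (E i c)) y))"
proof -
  let ?E = "mat k l (\<lambda>(i, c). E i c)"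
  define L where "L = (\<lambda>v. ?E *\<^sub>v v) ` carrier_vec l"
  have "L \<in> grassmannian l k" unfolding L_def by (rule image_in_grassmannian[OF _ inj]) simp
  define A where "A = (SOME A. parametrizes l k A L)"
  have "parametrizes l k ?E L" unfolding parametrizes_def L_def using inj by simp
  then have "parametrizes l k A L" unfolding A_def by (rule someI)
  then have A: "A \<in> carrier_mat k l" and AL: "(\<lambda>v. A *\<^sub>v v) ` carrier_vec l = L"
    unfolding parametrizes_def by blast+
  define v where "v x = (SOME v. v \<in> carrier_vec l \<and> A *\<^sub>v v = ?E *\<^sub>v vec l x)" for x
  have v: "v x \<in> carrier_vec l" "A *\<^sub>v v x = ?E *\<^sub>v vec l x" for x
  proof -
    have "?E *\<^sub>v vec l x \<in> (\<lambda>v. A *\<^sub>v v) ` carrier_vec l" unfolding AL L_def by (rule imageI) simp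
    then have "\<exists>v. v \<in> carrier_vec l \<and> A *\<^sub>v v = ?E *\<^sub>v vec l x" by (metis imageE)
    from someI_ex[OF this] show "v x \<in> carrier_vec l" "A *\<^sub>v v x = ?E *\<^sub>v vec l x"
      unfolding v_def by blast+
  qed
  have app: "lin_app l E x i = (\<Sum>j<l. A $$ (i, j) * v x $ j)" if "i < k" for x i
  proof -
    have "lin_app l E x i = (?E *\<^sub>v vec l x) $ i"
      using that by (simp add: lin_app_def scalar_prod_def atLeast0LessThan)
    also have "\<dots> = (A *\<^sub>v v x) $ i" by (simp add: v)
    also have "\<dots> = (\<Sum>j<l. A $$ (i, j) * v x $ j)"
      using that A v(1)[of x] by (simp add: scalar_prod_def atLeast0LessThan)
    finally show ?thesis .
  qed
  \<comment> \<open>The second substitution uses the conjugate matrix: conjugate \<open>y\<close>,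
    apply \<open>v\<close>, and conjugate the result.\<close>
  have app_cnj: "lin_app l (\<lambda>i c. cnj (E i c)) y i = (\<Sum>j<l. cnj (A $$ (i, j)) * cnj (v (\<lambda>c. cnj (y c)) $ j))"
    if "i < k" for y i
  proof -
    have "lin_app l (\<lambda>i c. cnj (E i c)) y i = cnj (lin_app l E (\<lambda>c. cnj (y c)) i)"
      by (simp add: lin_app_def)
    then show ?thesis by (simp add: app[OF that])
  qed
  have "poly_rank l d (compose_linear r A) \<le> K"
    using ranks[OF \<open>L \<in> grassmannian l k\<close>] unfolding restriction_rank_def A_def .
  then have "kernel_rank_le K (polarized (compose_linear r A))"
    by (rule kernel_rank_le_polarized[OF bihomogeneous_compose_linear[OF r A]])
  from kernel_rank_le_precomp[OF this, where \<phi> = "\<lambda>x j. v x $ j"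
      and \<psi> = "\<lambda>y j. cnj (v (\<lambda>c. cnj (y c)) $ j)"]
  have "kernel_rank_le K (\<lambda>x y. polarized r (\<lambda>i. \<Sum>j<l. A $$ (i, j) * v x $ j)
      (\<lambda>i. \<Sum>j<l. cnj (A $$ (i, j)) * cnj (v (\<lambda>c. cnj (y c)) $ j)))"
    using A by (simp add: polarized_compose_linear[OF r])
  also have "(\<lambda>x y. polarized r (\<lambda>i. \<Sum>j<l. A $$ (i, j) * v x $ j)
      (\<lambda>i. \<Sum>j<l. cnj (A $$ (i, j)) * cnj (v (\<lambda>c. cnj (y c)) $ j))) =
      (\<lambda>x y. polarized r (lin_app l E x) (lin_app l (\<lambda>i c. cnj (E i c)) y))"
    by (intro ext polarized_cong[OF r]) (simp_all add: app app_cnj)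
  finally show ?thesis .
qed

text \<open>The real axis without finitely many points is infinite. Identities involving conjugation
  become polynomial for real parameters, and this extends them to complex ones.\<close>

lemma complex_poly_eq_0:
  fixes p :: "complex poly"
  assumes "finite S" "\<And>t. complex_of_real t \<notin> S \<Longrightarrow> poly p (complex_of_real t) = 0"
  shows "p = 0"
proof (rule ccontr)
  assume "p \<noteq> 0"
  then have "finite ({z. poly p z = 0} \<union> S)" using poly_roots_finite assms(1) by blast
  moreover have "range complex_of_real \<subseteq> {z. poly p z = 0} \<union> S" using assms(2) by blast
  ultimately have "finite (range complex_of_real)" by (rule rev_finite_subset)
  then have "finite (UNIV :: real set)" by (rule finite_imageD) (simp add: inj_on_def)
  then show False by (simp add: infinite_UNIV_char_0)
qed

lemma finite_not_injective:
  fixes E :: "nat \<Rightarrow> nat \<Rightarrow> complex"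
  assumes "l \<le> k"
  shows "finite {t. \<not> inj_on (\<lambda>v. mat k l (\<lambda>(i, c). E i c + t * (if i = c then 1 else 0)) *\<^sub>v v) (carrier_vec l)}"
proof -
  \<comment> \<open>A parameter with a nontrivial kernel gives an eigenvalue of the upper \<open>l \<times> l\<close> block.\<close>
  let ?M = "\<lambda>t. mat k l (\<lambda>(i, c). E i c + t * (if i = c then 1 else 0))"
  define A where "A = mat l l (\<lambda>(i, c). E i c)"
  have A: "A \<in> carrier_mat l l" by (simp add: A_def)
  have "poly (char_poly A) (- t) = 0" if t: "\<not> inj_on (\<lambda>v. ?M t *\<^sub>v v) (carrier_vec l)" for t
  proof -
    obtain x y where xy: "x \<in> carrier_vec l" "y \<in> carrier_vec l" "?M t *\<^sub>v x = ?M t *\<^sub>v y" "x \<noteq> y"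
      using t unfolding inj_on_def by blast
    define u where "u = x - y"
    have u: "u \<in> carrier_vec l" using xy by (simp add: u_def)
    obtain i where "i < l" "x $ i \<noteq> y $ i" using xy by (metis carrier_vecD eq_vecI)
    then have "u $ i \<noteq> 0" using xy by (simp add: u_def)
    then have "u \<noteq> 0\<^sub>v l" using \<open>i < l\<close> by auto
    have M0: "?M t *\<^sub>v u = 0\<^sub>v k"
      unfolding u_def by (subst mult_minus_distrib_mat_vec[of _ k l]) (use xy in auto)
    have "A *\<^sub>v u = (- t) \<cdot>\<^sub>v u"
    proof (rule eq_vecI)
      fix i assume "i < dim_vec ((- t) \<cdot>\<^sub>v u)"
      then have "i < l" using u by simp
      have "0 = (?M t *\<^sub>v u) $ i" using M0 \<open>i < l\<close> assms by simp
      also have "\<dots> = (\<Sum>c<l. (E i c + t * (if i = c then 1 else 0)) * u $ c)"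
        using \<open>i < l\<close> assms u by (simp add: scalar_prod_def atLeast0LessThan)
      also have "\<dots> = (\<Sum>c<l. E i c * u $ c) + (\<Sum>c<l. if i = c then t * u $ c else 0)"
        unfolding sum.distrib[symmetric] by (intro sum.cong) (auto simp: algebra_simps)
      also have "(\<Sum>c<l. if i = c then t * u $ c else 0) = t * u $ i"
        using \<open>i < l\<close> by simp
      also have "(\<Sum>c<l. E i c * u $ c) = (A *\<^sub>v u) $ i"
        using \<open>i < l\<close> u by (simp add: A_def scalar_prod_def atLeast0LessThan)
      finally show "(A *\<^sub>v u) $ i = ((- t) \<cdot>\<^sub>v u) $ i"
        using \<open>i < l\<close> u by (simp add: eq_neg_iff_add_eq_0)
    qed (use u A in simp)
    then have "eigenvalue A (- t)"
      unfolding eigenvalue_def eigenvector_def using u \<open>u \<noteq> 0\<^sub>v l\<close> A by auto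
    then show ?thesis using eigenvalue_root_char_poly[OF A] by simp
  qed
  then have "{t. \<not> inj_on (\<lambda>v. ?M t *\<^sub>v v) (carrier_vec l)} \<subseteq> uminus ` {s. poly (char_poly A) s = 0}"
    by (force intro: image_eqI[where x = "- t" for t])
  moreover have "char_poly A \<noteq> 0" using degree_monic_char_poly[OF A] by auto
  ultimately show ?thesis using poly_roots_finite finite_subset by blast
qed

text \<open>A minor, polynomial along lines of pairs \<open>(E, F)\<close>, vanishes when
  \<open>E\<close> is injective and \<open>F\<close> its conjugate, then on all conjugate pairs, and
  finally everywhere, since conjugate pairs form a real form of the space of pairs.\<close>

lemma kernel_rank_le_all_maps:
  assumes r: "bihomogeneous k d r" and "l \<le> k"
    and ranks: "\<And>L. L \<in> grassmannian l k \<Longrightarrow> restriction_rank l k d r L \<le> K"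
  shows "kernel_rank_le K (\<lambda>x y. polarized r (lin_app l E x) (lin_app l F y))"
proof (rule kernel_rank_leI_minor_det)
  fix xs ys
  define \<Psi> where
    "\<Psi> E F = minor_det (Suc K) (\<lambda>x y. polarized r (lin_app l E x) (lin_app l F y)) xs ys" for E F
  have line: "\<exists>p. \<forall>t. \<Psi> (\<lambda>i c. E i c + t * E' i c) (\<lambda>i c. F i c + t * F' i c) = poly p t"
    for E E' F F'
    unfolding \<Psi>_def minor_det_def lin_app_line by (intro det_poly_entries polarized_line)
  have conj: "\<Psi> E (\<lambda>i c. cnj (E i c)) = 0" for E
  proof -
    \<comment> \<open>The rectangular identity is real, so the perturbed matrices stay conjugate for
      real \<open>t\<close>; all but finitely many \<open>t\<close> make the first one
      injective.\<close>
    let ?I = "\<lambda>i c. if i = c then 1 else 0 :: complex"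
    obtain p where p: "\<And>t. \<Psi> (\<lambda>i c. E i c + t * ?I i c) (\<lambda>i c. cnj (E i c) + t * ?I i c) = poly p t"
      using line[of E ?I "\<lambda>i c. cnj (E i c)" ?I] by blast
    have "p = 0"
    proof (rule complex_poly_eq_0[OF finite_not_injective[OF \<open>l \<le> k\<close>, of E]])
      fix t
      assume "complex_of_real t \<notin> {t. \<not> inj_on (\<lambda>v. mat k l (\<lambda>(i, c). E i c + t * ?I i c) *\<^sub>v v) (carrier_vec l)}"
      then have "inj_on (\<lambda>v. mat k l (\<lambda>(i, c). E i c + complex_of_real t * ?I i c) *\<^sub>v v) (carrier_vec l)"
        by simp
      from minor_det_eq_0[OF kernel_rank_le_injective[OF r ranks this]]
      have "\<Psi> (\<lambda>i c. E i c + complex_of_real t * ?I i c)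
          (\<lambda>i c. cnj (E i c + complex_of_real t * ?I i c)) = 0"
        unfolding \<Psi>_def by simp
      moreover have "(\<lambda>i c. cnj (E i c + complex_of_real t * ?I i c))
          = (\<lambda>i c. cnj (E i c) + complex_of_real t * ?I i c)" by (auto simp: fun_eq_iff)
      ultimately show "poly p (complex_of_real t) = 0" by (simp only: p)
    qed
    then show ?thesis using p[of 0] by simp
  qed
  \<comment> \<open>\<open>\<Psi> (P + t Q) (\<bar>P + t \<bar>Q)\<close> vanishes for real \<open>t\<close>, hence also for \<open>t = \<i>\<close>.\<close>
  define P where "P i c = (E i c + cnj (F i c)) / 2" for i c
  define Q where "Q i c = (E i c - cnj (F i c)) / (2 * \<i>)" for i c
  obtain p where p: "\<And>t. \<Psi> (\<lambda>i c. P i c + t * Q i c) (\<lambda>i c. cnj (P i c) + t * cnj (Q i c)) = poly p t"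
    using line[of P Q "\<lambda>i c. cnj (P i c)" "\<lambda>i c. cnj (Q i c)"] by blast
  have "p = 0"
  proof (rule complex_poly_eq_0[of "{}"])
    fix t
    have "\<Psi> (\<lambda>i c. P i c + complex_of_real t * Q i c) (\<lambda>i c. cnj (P i c + complex_of_real t * Q i c)) = 0"
      by (rule conj)
    then show "poly p (complex_of_real t) = 0" by (simp add: p[symmetric])
  qed simp
  then have "\<Psi> (\<lambda>i c. P i c + \<i> * Q i c) (\<lambda>i c. cnj (P i c) + \<i> * cnj (Q i c)) = 0"
    by (simp add: p)
  \<comment> \<open>\<open>P\<close> and \<open>Q\<close> were found by solving the first equation
    together with the conjugate of the second, in which \<open>\<i>\<close> becomes
    \<open>- \<i>\<close>.\<close>
  moreover have "(\<lambda>i c. P i c + \<i> * Q i c) = E" "(\<lambda>i c. cnj (P i c) + \<i> * cnj (Q i c)) = F"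
    by (auto simp: fun_eq_iff P_def Q_def field_simps)
  ultimately show "minor_det (Suc K) (\<lambda>x y. polarized r (lin_app l E x) (lin_app l F y)) xs ys = 0"
    by (simp add: \<Psi>_def)
qed

section \<open>From coordinate lines to the whole space\<close>

text \<open>The columns are the \<open>i\<close>-th unit vector, \<open>p\<close> with entry
  \<open>i\<close> set to 0, and zeros. This matrix need not be injective, which is why rank bounds
  for arbitrary matrices are wanted.\<close>

lemma fun_upd_lin_app:
  assumes "2 \<le> l"
  shows "p(i := t) = lin_app l (\<lambda>a c. if c = 0 then if a = i then 1 else 0
    else if c = 1 then if a = i then 0 else p a else 0) (\<lambda>c. if c = 0 then t else 1)"
proof -
  have "(\<Sum>c<l. h c) = h 0 + h 1" if "\<And>c. c \<ge> 2 \<Longrightarrow> h c = 0" for h :: "nat \<Rightarrow> complex"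
  proof -
    have "(\<Sum>c<l. h c) = (\<Sum>c\<in>{0, 1}. h c)"
      using assms that by (intro sum.mono_neutral_right) (auto simp: numeral_2_eq_2 Suc_le_eq)
    then show ?thesis by simp
  qed
  then show ?thesis by (auto simp: lin_app_def fun_eq_iff)
qed

text \<open>Coordinates are freed first in \<open>w\<close>, with \<open>z\<close> on a coordinate
  line, and then in \<open>z\<close>, with \<open>w\<close> arbitrary; each pass raises the bound to
  the power \<open>k\<close>.\<close>

lemma poly_rank_le_restriction_rank:
  assumes r: "bihomogeneous k d r" and l: "2 \<le> l" "l \<le> k"
    and ranks: "\<And>L. L \<in> grassmannian l k \<Longrightarrow> restriction_rank l k d r L \<le> K"
  shows "poly_rank k d r \<le> (K ^ k) ^ k"
proof -
  have lines: "kernel_rank_le K (\<lambda>t s. polarized r (p(i := t)) (q(j := s)))" for p q i j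
    unfolding fun_upd_lin_app[OF l(1)]
    by (rule kernel_rank_le_precomp[OF kernel_rank_le_all_maps[OF r l(2) ranks]])
  have poly_w: "poly_on_lines (\<lambda>w. polarized r z w)" for z
    unfolding poly_on_lines_def using polarized_line[of r z "\<lambda>_. 0"] by simp
  have poly_z: "poly_on_lines (\<lambda>z. polarized r z w)" for w
    unfolding poly_on_lines_def using polarized_line[of r _ _ w "\<lambda>_. 0"] by simp
  have half: "kernel_rank_le (K ^ k) (\<lambda>t w. polarized r (p(i := t)) w)" for p i
  proof -
    \<comment> \<open>The arguments are swapped because coordinates are freed in the first one.
      Those from \<open>k\<close> on are frozen at 0, which \<open>polarized r\<close> does not
      see.\<close>
    have "kernel_rank_le (K ^ k) (\<lambda>w t. polarized r (p(i := t)) (\<lambda>j. if j < k then w j else 0))"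
      by (rule kernel_rank_le_coordinates[where G = "\<lambda>w t. polarized r (p(i := t)) w" and k = k])
        (use poly_w kernel_rank_le_swap[OF lines] in auto)
    also have "(\<lambda>w t. polarized r (p(i := t)) (\<lambda>j. if j < k then w j else 0))
        = (\<lambda>w t. polarized r (p(i := t)) w)"
      by (intro ext polarized_cong[OF r]) auto
    finally show ?thesis by (rule kernel_rank_le_swap)
  qed
  have "kernel_rank_le ((K ^ k) ^ k) (\<lambda>z w. polarized r (\<lambda>j. if j < k then z j else 0) w)"
    by (rule kernel_rank_le_coordinates[where G = "polarized r" and k = k])
      (rule poly_z half order_refl)+
  also have "(\<lambda>z w. polarized r (\<lambda>j. if j < k then z j else 0) w) = polarized r"
    by (intro ext polarized_cong[OF r]) auto
  finally show ?thesis by (rule poly_rank_le_kernel_rank[OF r])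
qed

theorem theorem1p2:
  fixes n m :: nat
  assumes "n \<ge> 2" and "1 \<le> m" and "m \<le> n - 1"
  shows "\<exists>R :: nat \<Rightarrow> nat. \<forall>(d :: nat) (r :: zzbar_poly).
           bihomogeneous (n + 1) d r \<and> real_valued (n + 1) r \<longrightarrow>
           poly_rank (n + 1) d r
             \<le> R (MAX L\<in>grassmannian (m + 1) (n + 1). restriction_rank (m + 1) (n + 1) d r L)"
\<comment> \<open>There are \<open>n + 1\<close> variables, and \<open>1 \<le> m\<close> gives the
  subspaces dimension at least 2, enough to contain an affine line.\<close>
proof (intro exI[of _ "\<lambda>K. (K ^ (n + 1)) ^ (n + 1)"] allI impI)
  fix d r
  assume r: "bihomogeneous (n + 1) d r \<and> real_valued (n + 1) r"
  show "poly_rank (n + 1) d r \<le>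
      ((MAX L\<in>grassmannian (m + 1) (n + 1). restriction_rank (m + 1) (n + 1) d r L) ^ (n + 1)) ^ (n + 1)"
  proof (rule poly_rank_le_restriction_rank)
    show "restriction_rank (m + 1) (n + 1) d r L
        \<le> (MAX L\<in>grassmannian (m + 1) (n + 1). restriction_rank (m + 1) (n + 1) d r L)"
      if "L \<in> grassmannian (m + 1) (n + 1)" for L
      using that by (intro Max_ge finite_restriction_ranks imageI)
  qed (use r assms in auto)
qed

end
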